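(* Let $\mathfrak{k}$ be a field of characteristic $0$, let $f(x)=a_nx^n+a_{n-1}x^{n-1}+\dots+a_0\in\mathfrak{k}[x]$ be a polynomial of degree $n>0$, and let $(f_0,f_1,f_2,\dots)$ be its Sturm sequence. Let $j\ge 1$ and suppose that $\deg f_j=n-j$ (hence $\deg f_i=n-i$ for all $i\le j$). Then for all $1\le i\le j$ one has $c(i)\neq 0$ (so that $\gamma_1,\dots,\gamma_j$ are well defined) and $$f_i(x)=\gamma_i\cdot\sum_{p=0}^{n-i} c(i)_p\,x^{n-i-p}.$$ In particular, the leading coefficient of $f_i(x)$ is $\gamma_i\,c(i)$. Here the elements $c(i)_p$, $c(i)=c(i)_0$ and $\gamma_i$ of $\mathfrak{k}$ are the explicit expressions in the coefficients of $f$ given in the context.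
   Context: Sturm sequence: $f_0=f$, $f_1=f'$, and for $j\ge1$, $f_{j+1}$ is minus the remainder of the Euclidean division of $f_{j-1}$ by $f_j$: $f_{j-1}=q_{j-1}f_j-f_{j+1}$ with $\deg f_{j+1}<\deg f_j$. Put $a_i=0$ for $i<0$. For $j\ge1$, $i\ge 2j$ define $$b(j)_i=n\sum_{p=0}^{j-1}(i-2p)\,a_{n-p}\,a_{n-i+p}-j(n-i+j)\,a_{n-j}\,a_{n+j-i}.$$ For $m\ge2$ let $C(m)$ be the symmetric $(m-1)\times(m-1)$ matrix whose $(p,q)$ entry is $b(\min(p,q))_{p+q}$, $1\le p,q\le m-1$. For $i\ge0$ let $C(m)_i$ be the matrix obtained from $C(m)$ by replacing its last row by $$\bigl(b(1)_{m+i},\,b(2)_{m+i+1},\,b(3)_{m+i+2},\dots,\,b(m-1)_{2m+i-2}\bigr)$$ (so $C(m)_0=C(m)$). Put $c(m)_i=\det C(m)_i$ and $c(m)=c(m)_0$ for $m\ge 2$. Moreover put $c(1)_i=\dfrac{(n-i)a_{n-i}}{n a_n}$ for $i\ge0$, and $c(1)=c(1)_0=1$. Define $\gamma_j$ recursively by $\gamma_1=na_n$, $\gamma_2=-\dfrac{1}{n^2a_n}$ and $\gamma_{j+1}=\gamma_{j-1}\cdot\dfrac{c(j-1)^2}{c(j)^2}$ for $j\ge2$; thus $\gamma_1,\dots,\gamma_j$ are well defined as soon as $c(2),\dots,c(j-1)$ are all nonzero. *)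

theory Defs
  imports "HOL-Computational_Algebra.Polynomial" "Jordan_Normal_Form.Determinant"
begin

text \<open>
  The Sturm sequence ends with its last nonzero term.  It is extended by \<open>0\<close> here;
  without the case distinction, \<open>p mod 0 = p\<close> would produce spurious nonzero terms.
\<close>

fun sturm_seq :: "'k::field_char_0 poly \<Rightarrow> nat \<Rightarrow> 'k poly" where
  "sturm_seq f 0 = f"
| "sturm_seq f (Suc 0) = pderiv f"
| "sturm_seq f (Suc (Suc j)) =
     (if sturm_seq f (Suc j) = 0 then 0
      else - (sturm_seq f j mod sturm_seq f (Suc j)))"

text \<open>Coefficients with integer index, since the formulas below use \<open>a\<^sub>i = 0\<close> for \<open>i < 0\<close>.\<close>

definition icoeff :: "'k::field_char_0 poly \<Rightarrow> int \<Rightarrow> 'k" where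
  "icoeff f i = (if i < 0 then 0 else coeff f (nat i))"

text \<open>In the following, \<open>n\<close> is the degree of \<open>f\<close>; \<open>sturm_b f j i\<close> is \<open>b(j)\<^sub>i\<close>,
  meaningful for \<open>j \<ge> 1\<close> and \<open>i \<ge> 2 j\<close>.\<close>

definition sturm_b :: "'k::field_char_0 poly \<Rightarrow> nat \<Rightarrow> nat \<Rightarrow> 'k" where
  "sturm_b f j i = (let n = int (degree f) in
     of_int n * (\<Sum>p = 0..<j. of_int (int i - 2 * int p)
                    * icoeff f (n - int p) * icoeff f (n - int i + int p))
     - of_int (int j * (n - int i + int j))
         * icoeff f (n - int j) * icoeff f (n + int j - int i))"

text \<open>Matrix indices start at \<open>0\<close>, so the entry at \<open>(p, q)\<close> is the mathematical entry at
  \<open>(p + 1, q + 1)\<close>, and the last row has index \<open>m - 2\<close>.\<close>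

definition sturm_C :: "'k::field_char_0 poly \<Rightarrow> nat \<Rightarrow> 'k mat" where
  "sturm_C f m = mat (m - 1) (m - 1)
     (\<lambda>(p, q). sturm_b f (min (p + 1) (q + 1)) ((p + 1) + (q + 1)))"

definition sturm_C_row :: "'k::field_char_0 poly \<Rightarrow> nat \<Rightarrow> nat \<Rightarrow> 'k mat" where
  "sturm_C_row f m i = mat (m - 1) (m - 1)
     (\<lambda>(p, q). if p = m - 2 then sturm_b f (q + 1) (m + i + q) else sturm_C f m $$ (p, q))"

text \<open>\<open>sturm_c f m i\<close> is \<open>c(m)\<^sub>i\<close>, and \<open>c(m)\<close> is \<open>sturm_c f m 0\<close>; only \<open>m \<ge> 1\<close> is meaningful.\<close>

definition sturm_c :: "'k::field_char_0 poly \<Rightarrow> nat \<Rightarrow> nat \<Rightarrow> 'k" where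
  "sturm_c f m i =
     (if m = 1
      then of_int (int (degree f) - int i) * icoeff f (int (degree f) - int i)
             / (of_nat (degree f) * lead_coeff f)
      else det (sturm_C_row f m i))"

text \<open>The value at \<open>0\<close> is arbitrary and never used by the other equations.\<close>

fun sturm_gamma :: "'k::field_char_0 poly \<Rightarrow> nat \<Rightarrow> 'k" where
  "sturm_gamma f 0 = 0"
| "sturm_gamma f (Suc 0) = of_nat (degree f) * lead_coeff f"
| "sturm_gamma f (Suc (Suc 0)) = - (1 / ((of_nat (degree f))\<^sup>2 * lead_coeff f))"
| "sturm_gamma f (Suc (Suc (Suc j))) =
     sturm_gamma f (Suc j) * ((sturm_c f (Suc j) 0)\<^sup>2 / (sturm_c f (Suc (Suc j)) 0)\<^sup>2)"

end

theory Submission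
  imports Defs
begin

text \<open>
  The numbers \<open>b(q)\<^bsub>p+q\<^esub>\<close> are the entries of a Bezout matrix.  They are symmetric in
  \<open>p\<close> and \<open>q\<close>, and for each \<open>q\<close> the polynomial \<open>H\<^sub>q = \<Sum>\<^sub>p b(q)\<^bsub>p+q\<^esub> x\<^bsup>n-1-p\<^esup>\<close>
  (\<open>bez_poly\<close>) has the form \<open>u\<^sub>q f + v\<^sub>q f'\<close>, where \<open>u\<^sub>q\<close> has degree less than \<open>q\<close> and \<open>v\<^sub>q\<close> has
  degree \<open>q\<close> and leading coefficient \<open>- n a\<^sub>n\<close> (\<open>coeff_bez_poly\<close>).

  Expanding \<open>c(m)\<^sub>i\<close> along its last row turns \<open>\<Sum>\<^sub>i c(m)\<^sub>i x\<^bsup>n-m-i\<^esup>\<close> into a combination of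
  \<open>H\<^sub>1, \<dots>, H\<^bsub>m-1\<^esub>\<close> with constant coefficients: the powers of \<open>x\<close> above \<open>n - m\<close> cancel because
  their coefficients are determinants with two equal rows (\<open>coeff_bez_subresultant\<close>).  So this
  polynomial of degree at most \<open>n - m\<close> is \<open>U f + V f'\<close> with \<open>U\<close> of degree less than \<open>m - 1\<close> and
  \<open>V\<close> of degree at most \<open>m - 1\<close>, and the coefficient of \<open>x\<^bsup>m-1\<^esup>\<close> in \<open>V\<close> is
  \<open>- n a\<^sub>n c(m - 1)\<close>.

  When all earlier Euclidean quotients are linear, these bounds force
  \<open>U f + V f'\<close> to be a multiple of \<open>f\<^sub>m\<close>, and the factor can be read off from the top coefficient
  of \<open>V\<close> (\<open>euclid_cofactor_unique\<close>).  The result is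
  \<open>\<Sum>\<^sub>i c(m)\<^sub>i x\<^bsup>n-m-i\<^esup> = - n c(m - 1) lead(f\<^bsub>m-1\<^esub>) f\<^sub>m\<close>.  By induction the leading coefficient
  of \<open>f\<^bsub>m-1\<^esub>\<close> is \<open>\<gamma>\<^bsub>m-1\<^esub> c(m - 1)\<close>, and the recursion of the \<open>\<gamma>\<^sub>m\<close> says that
  \<open>n \<gamma>\<^sub>m \<gamma>\<^bsub>m-1\<^esub> c(m - 1)\<^sup>2 = - 1\<close> for all \<open>m \<ge> 2\<close> (\<open>sturm_gamma_invariant\<close>), which is exactly
  the normalisation that makes \<open>\<gamma>\<^sub>m\<close> the inverse of this factor.
\<close>

section \<open>Cofactors in a signed Euclidean sequence\<close>

text \<open>
  Substituting \<open>F\<^sub>0 = q F\<^sub>1 - F\<^sub>2\<close> turns \<open>P F\<^sub>0 + Q F\<^sub>1\<close> into \<open>(P q + Q) F\<^sub>1 - P F\<^sub>2\<close>.  Since the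
  combination has small degree, \<open>P q + Q\<close> must cancel down to degree below the bound for \<open>P\<close>, so both
  cofactor bounds drop by one with each division step, until only a constant multiple of the last
  term is left.  The same cancellation makes each step divide the top coefficient of the second
  cofactor by the leading coefficient of \<open>q\<close>, and the product of these quotients telescopes.  The
  bounds on the cofactors are given by coefficients because \<open>P\<close> has to vanish for \<open>d = 0\<close>.
\<close>

lemma euclid_cofactor_unique:
  fixes F :: "nat \<Rightarrow> 'k::field poly"
  assumes "\<And>i. i \<le> d \<Longrightarrow> F i \<noteq> 0 \<and> degree (F i) = e + (d - i)"
    and "e > 0" and "degree (F (Suc d)) < e"
    and "\<And>i. i < d \<Longrightarrow> \<exists>q. F i = q * F (Suc i) - F (Suc (Suc i))"
    and "degree (P * F 0 + Q * F 1) < e"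
    and "\<And>i. i \<ge> d \<Longrightarrow> coeff P i = 0" and "\<And>i. i > d \<Longrightarrow> coeff Q i = 0"
  shows "P * F 0 + Q * F 1 = smult (coeff Q d * lead_coeff (F d) / lead_coeff (F 0)) (F (Suc d))"
  using assms
proof (induction d arbitrary: F P Q)
  case 0
  have "P = 0" using "0.prems"(6) by (intro poly_eqI) auto
  moreover have "Q = [:coeff Q 0:]"
    using "0.prems"(7) by (intro poly_eqI) (auto simp: coeff_pCons split: nat.splits)
  then have "Q * F 1 = smult (coeff Q 0) (F 1)"
    by (metis mult_pCons_left add.right_neutral mult_zero_left pCons_0_0)
  moreover have "lead_coeff (F 0) \<noteq> 0"
    using "0.prems"(1)[of 0] unfolding leading_coeff_0_iff by blast
  ultimately show ?case by simp
next
  case (Suc d)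
  obtain q where q: "F 0 = q * F 1 - F 2"
    using Suc.prems(4)[of 0] by (auto simp: numeral_2_eq_2)
  have F0: "F 0 \<noteq> 0" "degree (F 0) = e + Suc d" using Suc.prems(1)[of 0] by auto
  have F1: "F 1 \<noteq> 0" "degree (F 1) = e + d" using Suc.prems(1)[of 1] by auto
  have F2: "degree (F 2) < e + d"
  proof (cases d)
    case 0 then show ?thesis using Suc.prems(3) by (simp add: numeral_2_eq_2)
  next
    case (Suc d')
    then show ?thesis using Suc.prems(1)[of 2] \<open>e > 0\<close> by auto
  qed
  \<comment> \<open>the quotient is linear, with leading coefficient the ratio of the leading coefficients\<close>
  have lF2: "coeff (F 2) (e + Suc d) = 0" using F2 by (intro coeff_eq_0) simp
  have "degree (F 0 + F 2) = e + Suc d"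
    using F0 F2 by (subst degree_add_eq_left) auto
  moreover have qF: "q * F 1 = F 0 + F 2" using q by simp
  ultimately have dq: "degree (q * F 1) = e + Suc d" by simp
  then have "q \<noteq> 0" by auto
  then have degq: "degree q = 1" using dq F1 by (simp add: degree_mult_eq)
  have "lead_coeff q * lead_coeff (F 1) = coeff (F 0 + F 2) (e + Suc d)"
    using dq qF by (metis lead_coeff_mult)
  then have lq: "coeff q 1 * lead_coeff (F 1) = lead_coeff (F 0)"
    using degq F0 lF2 by simp
  define P' where "P' = P * q + Q"
  have R: "P * F 0 + Q * F 1 = P' * F 1 + (- P) * F 2"
    unfolding P'_def q by (simp add: algebra_simps)
  have dP: "degree P \<le> d"
    using Suc.prems(6) by (intro degree_le) auto
  have "degree (P * F 2) < e + d + d"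
    using degree_mult_le[of P "F 2"] dP F2 by linarith
  moreover have "P' * F 1 = (P * F 0 + Q * F 1) + P * F 2" unfolding R by simp
  ultimately have "degree (P' * F 1) < e + d + d"
    using Suc.prems(5) by (metis degree_add_less trans_less_add1)
  then have P': "coeff P' i = 0" if "i \<ge> d" for i
    using that F1 by (cases "P' = 0") (auto simp: degree_mult_eq intro!: coeff_eq_0)
  have "coeff (P * q) (Suc d) = coeff P d * coeff q 1"
  proof (cases "degree P = d")
    case True
    then show ?thesis using degq coeff_mult_degree_sum[of P q] by simp
  next
    case False
    then have "degree P < d" using dP by simp
    moreover from this have "degree (P * q) < Suc d"
      using degree_mult_le[of P q] degq by linarith
    ultimately show ?thesis by (simp add: coeff_eq_0)
  qed
  \<comment> \<open>the top terms of \<open>P q\<close> and \<open>Q\<close> cancel\<close>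
  then have lP: "coeff Q (Suc d) = - (coeff P d * coeff q 1)"
    using P'[of "Suc d"] unfolding P'_def by (simp add: add_eq_0_iff)
  have "P' * F (Suc 0) + (- P) * F (Suc 1) =
      smult (coeff (- P) d * lead_coeff (F (Suc d)) / lead_coeff (F (Suc 0))) (F (Suc (Suc d)))"
  proof (rule Suc.IH[of "\<lambda>i. F (Suc i)" P' "- P"])
    show "F (Suc i) \<noteq> 0 \<and> degree (F (Suc i)) = e + (d - i)" if "i \<le> d" for i
      using Suc.prems(1)[of "Suc i"] that by simp
    show "degree (P' * F (Suc 0) + - P * F (Suc 1)) < e"
      using Suc.prems(5) R by (simp add: numeral_2_eq_2)
    show "coeff (- P) i = 0" if "d < i" for i using Suc.prems(6)[of i] that by simp
  qed (use Suc.prems P' in auto)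
  moreover have "coeff (- P) d * lead_coeff (F (Suc d)) / lead_coeff (F (Suc 0)) =
      coeff Q (Suc d) * lead_coeff (F (Suc d)) / lead_coeff (F 0)"
  proof -
    have "lead_coeff (F 0) \<noteq> 0" "lead_coeff (F 1) \<noteq> 0"
      using F0(1) F1(1) by (simp_all only: leading_coeff_0_iff not_False_eq_True)
    then have "coeff P d / lead_coeff (F 1) = coeff P d * coeff q 1 / lead_coeff (F 0)"
      unfolding lq[symmetric] by simp
    from arg_cong[OF this, of "\<lambda>x. - x * lead_coeff (F (Suc d))"] show ?thesis
      unfolding lP by (simp add: mult_ac)
  qed
  ultimately show ?case using R by (simp only: numeral_2_eq_2 One_nat_def)
qed

section \<open>The Bezout entries\<close>

text \<open>
  The reflection \<open>s \<mapsto> p + q - s\<close> of the interval changes the sign of every summand.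
\<close>

lemma antisymmetric_sum_eq_0:
  fixes w :: "nat \<Rightarrow> 'k::field_char_0"
  shows "(\<Sum>s = p..q. of_int (int (p + q) - 2 * int s) * w s * w (p + q - s)) = 0"
    (is "?S = 0")
proof -
  have "?S = (\<Sum>s = p..q. of_int (int (p + q) - 2 * int (q + p - s)) * w (q + p - s) * w (p + q - (q + p - s)))"
    by (rule sum.atLeastAtMost_rev)
  also have "\<dots> = (\<Sum>s = p..q. - (of_int (int (p + q) - 2 * int s) * w s * w (p + q - s)))"
    by (rule sum.cong) (auto simp: add.commute of_nat_diff algebra_simps)
  also have "\<dots> = - ?S" by (simp add: sum_negf)
  finally have "2 * ?S = 0" by simp
  then show ?thesis by simp
qed

text \<open>
  The coefficients of the reciprocal polynomial \<open>x\<^sup>n f(1/x)\<close>, for which the formula for \<open>b(j)\<^sub>i\<close>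
  becomes a convolution.
\<close>

definition top_coeff :: "'k::field_char_0 poly \<Rightarrow> nat \<Rightarrow> 'k" where
  "top_coeff f s = icoeff f (int (degree f) - int s)"

lemma icoeff_gt_degree: "i > int (degree f) \<Longrightarrow> icoeff f i = 0"
  by (auto simp: icoeff_def intro!: coeff_eq_0)

lemma sturm_b_top_coeff:
  assumes "j \<le> i"
  shows "sturm_b f j i = of_nat (degree f) *
      (\<Sum>p = 0..<j. of_int (int i - 2 * int p) * top_coeff f p * top_coeff f (i - p))
    - of_int (int j * (int (degree f) - int i + int j)) * top_coeff f j * top_coeff f (i - j)"
proof -
  have *: "int (degree f) - int i + int p = int (degree f) - int (i - p)"
    if "p \<le> j" for p using that assms by auto
  have **: "int (degree f) + int j - int i = int (degree f) - int (i - j)"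
    using assms by auto
  show ?thesis unfolding sturm_b_def Let_def top_coeff_def
    by (simp add: * ** del: of_nat_diff)
qed

text \<open>
  The two sums differ by the terms with \<open>p \<le> s < q\<close>; the interval from \<open>p\<close> to \<open>q\<close> contributes
  nothing, so the difference is, up to sign, the term at \<open>q\<close>, which the two correction terms of \<open>b\<close> compensate.
\<close>

lemma sturm_b_symmetric_le:
  assumes "p \<le> q"
  shows "sturm_b f p (p + q) = sturm_b f q (p + q)"
proof -
  define w where "w = top_coeff f"
  define t where "t s = of_int (int (p + q) - 2 * int s) * w s * w (p + q - s)" for s
  have "{0..<q} = {0..<p} \<union> {p..<q}" using assms by auto
  then have "sum t {0..<q} = sum t {0..<p} + sum t {p..<q}"
    by (simp add: sum.union_disjoint)
  moreover have "sum t {p..q} = sum t {p..<q} + t q"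
    using assms by (simp add: sum.last_plus)
  moreover have "sum t {p..q} = 0" unfolding t_def by (rule antisymmetric_sum_eq_0)
  ultimately have s: "sum t {0..<q} = sum t {0..<p} - t q" by (simp add: algebra_simps)
  have "sturm_b f k (p + q) = of_nat (degree f) * sum t {0..<k}
      - of_int (int k * (int (degree f) - int (p + q) + int k)) * w k * w (p + q - k)"
    if "k \<le> p + q" for k
    using sturm_b_top_coeff[OF that, of f] unfolding t_def w_def .
  from this[of p] this[of q] show ?thesis
    by (simp add: s) (simp add: t_def algebra_simps)
qed

lemma sturm_b_symmetric: "sturm_b f p (p + q) = sturm_b f q (p + q)"
  by (metis sturm_b_symmetric_le add.commute nat_le_linear)

text \<open>
  These are the coefficients of \<open>x\<^bsup>n-1\<^esup>\<close> and of all higher powers in \<open>H\<^sub>q\<close>.  For \<open>i < q\<close> the sum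
  extends over the whole support of the convolution, where it is antisymmetric; for \<open>i = q\<close> symmetry
  gives \<open>b(0)\<^sub>q\<close>, an empty sum.
\<close>

lemma sturm_b_eq_0:
  assumes "i \<le> q"
  shows "sturm_b f q i = 0"
proof (cases "i = q")
  case True
  then show ?thesis using sturm_b_symmetric[of f 0 q] by (simp add: sturm_b_def)
next
  case False
  with assms have iq: "i < q" by simp
  define n where "n = int (degree f)"
  define t where "t p = of_int (int i - 2 * int p) * icoeff f (n - int p) * icoeff f (n - int i + int p)" for p
  have "{0..<q} = {0..i} \<union> {i<..<q}" using iq by auto
  then have "sum t {0..<q} = sum t {0..i} + sum t {i<..<q}"
    by (simp only:) (intro sum.union_disjoint, auto)
  moreover have "sum t {i<..<q} = 0"
    by (intro sum.neutral) (auto simp: t_def n_def icoeff_gt_degree)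
  moreover have "sum t {0..i} = (\<Sum>s = 0..i. of_int (int (0 + i) - 2 * int s) * top_coeff f s * top_coeff f (0 + i - s))"
    by (intro sum.cong) (auto simp: t_def top_coeff_def n_def of_nat_diff algebra_simps)
  ultimately have "sum t {0..<q} = 0" by (simp only: antisymmetric_sum_eq_0) simp
  moreover have "icoeff f (n + int q - int i) = 0" using iq by (intro icoeff_gt_degree) (simp add: n_def)
  ultimately show ?thesis
    unfolding sturm_b_def Let_def n_def[symmetric] t_def[symmetric] by simp
qed

section \<open>The Bezout rows as combinations of a polynomial and its derivative\<close>

definition bez_u :: "'k::field_char_0 poly \<Rightarrow> nat \<Rightarrow> 'k poly" where
  "bez_u f q = (\<Sum>s<q. monom (of_nat (degree f) * of_int (int (degree f) - int s) * top_coeff f s) (q - 1 - s))"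

definition bez_v :: "'k::field_char_0 poly \<Rightarrow> nat \<Rightarrow> 'k poly" where
  "bez_v f q = - (\<Sum>s<q. monom (of_nat (degree f) * top_coeff f s) (q - s)) - [:of_nat q * top_coeff f q:]"

definition bez_poly :: "'k::field_char_0 poly \<Rightarrow> nat \<Rightarrow> 'k poly" where
  "bez_poly f q = bez_u f q * f + bez_v f q * pderiv f"

text \<open>
  Grouping by \<open>s\<close> exhibits the polynomials \<open>(n - s) f - x f'\<close>, whose \<open>k\<close>-th coefficient is
  \<open>(n - s - k) a\<^sub>k\<close>; these linear factors are the weights \<open>i - 2 p\<close> in the definition of \<open>b(j)\<^sub>i\<close>.
\<close>

lemma bez_poly_eq:
  "bez_poly f q =
    (\<Sum>s<q. monom (of_nat (degree f) * top_coeff f s) (q - 1 - s) *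
       (smult (of_int (int (degree f) - int s)) f - pCons 0 (pderiv f)))
    - smult (of_nat q * top_coeff f q) (pderiv f)"
proof -
  have 1: "monom c (q - s) * pderiv f = monom c (q - 1 - s) * pCons 0 (pderiv f)"
    if "s < q" for s and c :: 'a
  proof -
    have "q - s = Suc (q - 1 - s)" using that by simp
    then show ?thesis by (simp only: monom_Suc) simp
  qed
  have 2: "monom (a * b * c) k * f = monom (a * c) k * smult b f" for a b c :: 'a and k
  proof -
    have "monom (a * b * c) k = smult b (monom (a * c) k)" by (simp add: smult_monom mult_ac)
    then show ?thesis by simp
  qed
  have "bez_v f q * pderiv f =
      - (\<Sum>s<q. monom (of_nat (degree f) * top_coeff f s) (q - 1 - s) * pCons 0 (pderiv f))
      - smult (of_nat q * top_coeff f q) (pderiv f)"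
    unfolding bez_v_def by (simp add: 1 left_diff_distrib sum_distrib_right del: mult_pCons_right)
  moreover have "bez_u f q * f = (\<Sum>s<q. monom (of_nat (degree f) * top_coeff f s) (q - 1 - s) *
       smult (of_int (int (degree f) - int s)) f)"
    unfolding bez_u_def sum_distrib_right 2 ..
  ultimately show ?thesis
    unfolding bez_poly_def by (simp add: right_diff_distrib sum_subtractf del: mult_pCons_right mult_smult_right)
qed

lemma coeff_euler_part:
  "coeff (smult (of_int (int n - int s)) f - pCons 0 (pderiv f)) k =
    of_int (int n - int s - int k) * (coeff f k :: 'k::field_char_0)"
  by (cases k) (simp_all add: coeff_pCons coeff_pderiv algebra_simps)

lemma coeff_bez_poly:
  assumes "Suc (e + i) = q + degree f"
  shows "coeff (bez_poly f q) e = sturm_b f q i"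
proof -
  define n where "n = degree f"
  have e: "int e = int q + int n - int i - 1" using assms by (simp add: n_def)
  have "coeff (monom (of_nat n * top_coeff f s) (q - 1 - s) *
       (smult (of_int (int n - int s)) f - pCons 0 (pderiv f))) e =
     of_nat n * (of_int (int i - 2 * int s) * icoeff f (int n - int s) * icoeff f (int n - int i + int s))"
    if "s < q" for s
  proof (cases "e < q - 1 - s")
    case True
    then have "int n - int i + int s < 0" using e that by linarith
    then show ?thesis using True by (simp add: coeff_monom_mult icoeff_def)
  next
    case False
    then have k: "int n - int i + int s = int (e - (q - 1 - s))" using e that by linarith
    then have "int n - int s - int (e - (q - 1 - s)) = int i - 2 * int s" by linarith
    then show ?thesis using False
      by (simp only: coeff_monom_mult coeff_euler_part k if_False)
         (simp add: icoeff_def top_coeff_def n_def del: of_nat_diff)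
  qed
  moreover have "coeff (smult (of_nat q * top_coeff f q) (pderiv f)) e =
      of_int (int q * (int n - int i + int q)) * icoeff f (int n - int q) * icoeff f (int n + int q - int i)"
  proof -
    have *: "int n + int q - int i = int (Suc e)" "int n - int i + int q = int (Suc e)"
      using e by linarith+
    show ?thesis unfolding * coeff_smult coeff_pderiv
      by (simp add: icoeff_def top_coeff_def n_def nat_add_distrib flip: of_nat_Suc)
  qed
  ultimately show ?thesis
    unfolding bez_poly_eq sturm_b_def Let_def n_def
    by (simp add: coeff_sum sum_distrib_left atLeast0LessThan)
qed

lemma degree_bez_u: "degree (bez_u f q) \<le> q - 1"
  unfolding bez_u_def
  by (intro degree_sum_le) (auto intro: order.trans[OF degree_monom_le])

lemma degree_bez_v: "degree (bez_v f q) \<le> q"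
  unfolding bez_v_def
  by (intro degree_diff_le) (auto intro!: degree_sum_le intro: order.trans[OF degree_monom_le])

lemma coeff_bez_poly_ge:
  assumes "degree f > 0" "e \<ge> q + degree f"
  shows "coeff (bez_poly f q) e = 0"
proof (cases "q = 0")
  case True
  then show ?thesis by (simp add: bez_poly_def bez_u_def bez_v_def)
next
  case False
  have "degree (bez_u f q * f) < e"
    using degree_mult_le[of "bez_u f q" f] degree_bez_u[of f q] assms False by linarith
  moreover have "degree (bez_v f q * pderiv f) < e"
    using degree_mult_le[of "bez_v f q" "pderiv f"] degree_bez_v[of f q] assms
      degree_pderiv[of f] by linarith
  ultimately show ?thesis unfolding bez_poly_def by (simp add: coeff_eq_0)
qed

section \<open>Expansion of the determinants along the last row\<close>

definition replace_last_row :: "'k::field_char_0 poly \<Rightarrow> nat \<Rightarrow> (nat \<Rightarrow> 'k) \<Rightarrow> 'k mat" where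
  "replace_last_row f k v = mat (Suc k) (Suc k)
     (\<lambda>(p, q). if p = k then v q else sturm_C f (k + 2) $$ (p, q))"

definition last_cofactor :: "'k::field_char_0 poly \<Rightarrow> nat \<Rightarrow> nat \<Rightarrow> 'k" where
  "last_cofactor f k q = cofactor (sturm_C f (k + 2)) k q"

lemma det_replace_last_row:
  "det (replace_last_row f k v) = (\<Sum>q<Suc k. v q * last_cofactor f k q)"
proof -
  have "replace_last_row f k v \<in> carrier_mat (Suc k) (Suc k)"
    by (simp add: replace_last_row_def)
  then have "det (replace_last_row f k v) =
      (\<Sum>q<Suc k. replace_last_row f k v $$ (k, q) * cofactor (replace_last_row f k v) k q)"
    by (rule laplace_expansion_row) simp
  moreover have "mat_delete (replace_last_row f k v) k q = mat_delete (sturm_C f (k + 2)) k q" for q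
    by (rule eq_matI) (auto simp: mat_delete_def replace_last_row_def sturm_C_def)
  ultimately show ?thesis
    by (simp add: cofactor_def last_cofactor_def replace_last_row_def)
qed

text \<open>
  By symmetry the minimum in the definition of \<open>C(m)\<close> can be replaced by the column index, so that the
  rows of \<open>C(m)\<close> and the replacement rows in \<open>C(m)\<^sub>i\<close> are given by the same formula.
\<close>

lemma sturm_C_entry:
  assumes "p \<le> k" "q \<le> k"
  shows "sturm_C f (k + 2) $$ (p, q) = sturm_b f (q + 1) (p + q + 2)"
proof -
  have "sturm_b f (p + 1) (p + q + 2) = sturm_b f (q + 1) (p + q + 2)"
    using sturm_b_symmetric[of f "p + 1" "q + 1"] by simp
  then show ?thesis using assms by (auto simp: sturm_C_def min_def)
qed

lemma sturm_c_cofactor: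
  "sturm_c f (k + 2) i = (\<Sum>q<Suc k. sturm_b f (q + 1) (k + 2 + i + q) * last_cofactor f k q)"
proof -
  have "sturm_C_row f (k + 2) i = replace_last_row f k (\<lambda>q. sturm_b f (q + 1) (k + 2 + i + q))"
    by (simp add: sturm_C_row_def replace_last_row_def ac_simps cong: if_cong)
  then show ?thesis by (simp add: sturm_c_def det_replace_last_row del: sum.lessThan_Suc)
qed

text \<open>
  The sum is the determinant of \<open>C(k + 2)\<close> with a copy of an earlier row in the last place.
\<close>

lemma cofactor_orthogonal:
  assumes "r < k"
  shows "(\<Sum>q<Suc k. sturm_b f (q + 1) (r + q + 2) * last_cofactor f k q) = 0"
proof -
  let ?A = "replace_last_row f k (\<lambda>q. sturm_b f (q + 1) (r + q + 2))"
  have "det ?A = 0"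
  proof (rule det_identical_rows[of _ "Suc k" r k])
    show "row ?A r = row ?A k"
      using assms by (intro eq_vecI) (auto simp: replace_last_row_def sturm_C_entry simp flip: add_2_eq_Suc')
  qed (use assms in \<open>auto simp: replace_last_row_def\<close>)
  then show ?thesis by (simp only: det_replace_last_row)
qed

lemma sturm_c_one:
  assumes "degree f > 0"
  shows "sturm_c f 1 0 = 1"
  using assms by (auto simp: sturm_c_def icoeff_def)

lemma last_cofactor_last:
  assumes "degree f > 0"
  shows "last_cofactor f k k = sturm_c f (k + 1) 0"
proof (cases k)
  case 0
  have "mat_delete (sturm_C f 2) 0 0 \<in> carrier_mat 0 0"
    by (intro carrier_matI) (simp_all add: mat_delete_def sturm_C_def)
  then show ?thesis using 0 assms sturm_c_one[OF assms]
    by (simp add: last_cofactor_def cofactor_def numeral_2_eq_2)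
next
  case (Suc k')
  have "mat_delete (sturm_C f (k + 2)) k k = sturm_C_row f (k + 1) 0"
    by (rule eq_matI)
       (auto simp: Suc mat_delete_def sturm_C_def sturm_C_row_def min_def less_Suc_eq)
  then show ?thesis using Suc
    by (simp add: last_cofactor_def cofactor_def sturm_c_def)
qed

definition bez_subresultant :: "'k::field_char_0 poly \<Rightarrow> nat \<Rightarrow> 'k poly" where
  "bez_subresultant f k = (\<Sum>q<Suc k. smult (last_cofactor f k q) (bez_poly f (q + 1)))"

text \<open>
  The exponent \<open>e = n - 1 - r\<close> belongs to the row \<open>r\<close> of the Bezout matrix.  Rows from \<open>k + 1\<close> on give
  the determinants \<open>c(k + 2)\<^sub>i\<close>, rows \<open>1, \<dots>, k\<close> already occur in \<open>C(k + 2)\<close>, and for \<open>r \<le> 0\<close>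
  the entries themselves vanish.
\<close>

lemma coeff_bez_subresultant:
  assumes "k + 2 \<le> degree f"
  shows "coeff (bez_subresultant f k) e =
    (if e \<le> degree f - (k + 2) then sturm_c f (k + 2) (degree f - (k + 2) - e) else 0)"
proof -
  define n where "n = degree f"
  have n: "k + 2 \<le> n" using assms by (simp add: n_def)
  have sum: "coeff (bez_subresultant f k) e =
      (\<Sum>q<Suc k. coeff (bez_poly f (q + 1)) e * last_cofactor f k q)"
    by (simp add: bez_subresultant_def coeff_sum mult.commute del: sum.lessThan_Suc)
  consider "e \<le> n - (k + 2)" | "n - (k + 2) < e" "e < n - 1" | "n - 1 \<le> e" by linarith
  then show ?thesis
  proof cases
    case 1
    have "coeff (bez_poly f (q + 1)) e = sturm_b f (q + 1) (k + 2 + (n - (k + 2) - e) + q)" for q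
      using 1 n by (intro coeff_bez_poly) (simp add: n_def)
    then show ?thesis using 1 unfolding sum by (simp only: sturm_c_cofactor n_def if_True)
  next
    case 2
    have "coeff (bez_poly f (q + 1)) e = sturm_b f (q + 1) ((n - 2 - e) + q + 2)" for q
      using 2 n by (intro coeff_bez_poly) (simp add: n_def)
    moreover have "n - 2 - e < k" using 2 n by linarith
    ultimately show ?thesis using 2 unfolding sum
      by (simp only: cofactor_orthogonal n_def) simp
  next
    case 3
    have "coeff (bez_poly f (q + 1)) e = 0" for q
    proof (cases "q + 1 + n \<le> e")
      case True
      then show ?thesis using n by (intro coeff_bez_poly_ge) (auto simp: n_def)
    next
      case False
      then have "coeff (bez_poly f (q + 1)) e = sturm_b f (q + 1) (q + n - e)"
        by (intro coeff_bez_poly) (simp add: n_def)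
      also have "\<dots> = 0" using 3 n by (intro sturm_b_eq_0) linarith
      finally show ?thesis .
    qed
    then show ?thesis using 3 n unfolding sum n_def[symmetric] by simp
  qed
qed

section \<open>The Sturm sequence\<close>

lemma sum_monom_reversed:
  assumes "\<And>e. coeff p e = (if e \<le> d then c (d - e) else 0)"
  shows "p = (\<Sum>i = 0..d. monom (c i) (d - i))"
proof (rule poly_eqI)
  fix e
  have "coeff (\<Sum>i = 0..d. monom (c i) (d - i)) e = (\<Sum>i = 0..d. if d - i = e then c i else 0)"
    by (simp add: coeff_sum)
  also have "\<dots> = (\<Sum>i = 0..d. if i = d - e then (if e \<le> d then c i else 0) else 0)"
    by (intro sum.cong) auto
  also have "\<dots> = coeff p e" using assms by (simp add: sum.delta)
  finally show "coeff p e = coeff (\<Sum>i = 0..d. monom (c i) (d - i)) e" ..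
qed

lemma sturm_seq_degree_drop:
  assumes "degree f > 0" "sturm_seq f (Suc i) \<noteq> 0"
  shows "degree (sturm_seq f (Suc i)) < degree (sturm_seq f i)"
proof (cases i)
  case 0
  then show ?thesis using assms by (simp add: degree_pderiv)
next
  case (Suc k)
  with assms have "sturm_seq f (Suc k) \<noteq> 0"
      and "sturm_seq f k mod sturm_seq f (Suc k) \<noteq> 0"
    by (auto split: if_splits)
  then show ?thesis using Suc degree_mod_less[of "sturm_seq f (Suc k)" "sturm_seq f k"] by simp
qed

text \<open>
  The number \<open>deg f\<^sub>i + i\<close> does not increase while the sequence is nonzero; if it has the same value
  at both ends, it is constant.
\<close>

lemma sturm_seq_regular:
  assumes "degree f > 0" "sturm_seq f j \<noteq> 0" "degree (sturm_seq f j) + j = degree f" "i \<le> j"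
  shows "sturm_seq f i \<noteq> 0 \<and> degree (sturm_seq f i) + i = degree f"
proof -
  have nz: "sturm_seq f k \<noteq> 0" if "k \<le> j" for k
    using that
  proof (induction rule: inc_induct)
    case (step k)
    then show ?case using assms(1) by (cases k) auto
  qed (rule assms(2))
  have mono: "degree (sturm_seq f b) + b \<le> degree (sturm_seq f a) + a"
    if "a \<le> b" "b \<le> j" for a b
    using that
  proof (induction rule: dec_induct)
    case (step b)
    then show ?case using sturm_seq_degree_drop[OF assms(1) nz[of "Suc b"]] by simp
  qed simp
  show ?thesis using nz[OF assms(4)] mono[of 0 i] mono[of i j] assms by simp
qed

text \<open>
  Only the summand with \<open>s = 0\<close> reaches degree \<open>q\<close>.
\<close>

lemma coeff_bez_v_top:
  assumes "q > 0"
  shows "coeff (bez_v f q) q = - of_nat (degree f) * lead_coeff f"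
proof -
  obtain r where q: "q = Suc r" using assms gr0_conv_Suc by blast
  have "coeff (bez_v f q) q = - (\<Sum>s<q. if s = 0 then of_nat (degree f) * top_coeff f s else 0)"
    unfolding bez_v_def coeff_diff coeff_minus coeff_sum coeff_monom
    by (simp add: q coeff_pCons del: sum.lessThan_Suc sum.delta) (rule sum.cong, auto)
  then show ?thesis using assms by (simp add: top_coeff_def icoeff_def)
qed

text \<open>
  The cofactors meet the bounds of \<open>euclid_cofactor_unique\<close>, and the top coefficient of \<open>V\<close> comes from
  \<open>H\<^bsub>k+1\<^esub>\<close> alone, whose weight is the cofactor \<open>c(k + 1)\<close>.
\<close>

lemma bez_subresultant_sturm:
  assumes "k + 2 \<le> degree f"
    and reg: "\<And>i. i \<le> k + 1 \<Longrightarrow> sturm_seq f i \<noteq> 0 \<and> degree (sturm_seq f i) + i = degree f"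
  shows "bez_subresultant f k =
    smult (- (of_nat (degree f) * sturm_c f (k + 1) 0 * lead_coeff (sturm_seq f (k + 1))))
      (sturm_seq f (k + 2))"
proof -
  define U where "U = (\<Sum>q<Suc k. smult (last_cofactor f k q) (bez_u f (q + 1)))"
  define V where "V = (\<Sum>q<Suc k. smult (last_cofactor f k q) (bez_v f (q + 1)))"
  have G: "bez_subresultant f k = U * sturm_seq f 0 + V * sturm_seq f 1"
    by (simp add: bez_subresultant_def U_def V_def bez_poly_def sum_distrib_right
        smult_add_right sum.distrib del: sum.lessThan_Suc)
  have dU: "degree U \<le> k" unfolding U_def
    by (intro degree_sum_le) (auto intro!: order.trans[OF degree_smult_le] order.trans[OF degree_bez_u])
  have dV: "degree V \<le> k + 1" unfolding V_def
    by (intro degree_sum_le) (auto intro!: order.trans[OF degree_smult_le] order.trans[OF degree_bez_v])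
  have "coeff (bez_v f (q + 1)) (k + 1) = 0" if "q < k" for q
    using degree_bez_v[of f "q + 1"] that by (intro coeff_eq_0) simp
  then have lV: "coeff V (Suc k) = - (of_nat (degree f) * sturm_c f (k + 1) 0 * lead_coeff f)"
    using coeff_bez_v_top[of "k + 1" f] last_cofactor_last[of f k] assms(1)
    by (simp add: V_def coeff_sum)
  have "degree (bez_subresultant f k) \<le> degree f - (k + 2)"
    using assms(1) by (intro degree_le) (auto simp: coeff_bez_subresultant)
  then have dG: "degree (bez_subresultant f k) < degree f - Suc k" using assms(1) by linarith
  have rem: "degree (sturm_seq f (Suc (Suc k))) < degree f - Suc k"
  proof (cases "sturm_seq f (Suc (Suc k)) = 0")
    case True
    then show ?thesis using assms(1) by simp
  next
    case False
    then have "degree (sturm_seq f (Suc (Suc k))) < degree (sturm_seq f (Suc k))"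
      using assms(1) by (intro sturm_seq_degree_drop) auto
    moreover have "degree (sturm_seq f (Suc k)) = degree f - Suc k" using reg[of "k + 1"] by auto
    ultimately show ?thesis by simp
  qed
  have "U * sturm_seq f 0 + V * sturm_seq f 1 =
      smult (coeff V (Suc k) * lead_coeff (sturm_seq f (Suc k)) / lead_coeff (sturm_seq f 0))
        (sturm_seq f (Suc (Suc k)))"
  proof (rule euclid_cofactor_unique[where e = "degree f - Suc k"])
    show "sturm_seq f i \<noteq> 0 \<and> degree (sturm_seq f i) = degree f - Suc k + (Suc k - i)"
      if "i \<le> Suc k" for i using reg[of i] that assms(1)
      by simp linarith
    show "\<exists>q. sturm_seq f i = q * sturm_seq f (Suc i) - sturm_seq f (Suc (Suc i))"
      if "i < Suc k" for i
    proof -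
      have "sturm_seq f (Suc i) \<noteq> 0" using reg[of "Suc i"] that by auto
      then have "sturm_seq f i = sturm_seq f i div sturm_seq f (Suc i) * sturm_seq f (Suc i)
          - sturm_seq f (Suc (Suc i))"
        by (simp only: sturm_seq.simps if_False diff_minus_eq_add div_mult_mod_eq)
      then show ?thesis ..
    qed
    show "degree (U * sturm_seq f 0 + V * sturm_seq f 1) < degree f - Suc k"
      using dG unfolding G .
  qed (use rem dU dV assms(1) in \<open>auto intro: coeff_eq_0\<close>)
  moreover have "lead_coeff f \<noteq> 0" using assms(1) by auto
  ultimately show ?thesis unfolding G lV by (simp add: mult_ac)
qed

text \<open>
  The recursion relates \<open>\<gamma>\<^bsub>j+1\<^esub>\<close> to \<open>\<gamma>\<^bsub>j-1\<^esub>\<close>, whereas the Euclidean algorithm determines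
  \<open>f\<^bsub>j+1\<^esub>\<close> from the leading coefficient of \<open>f\<^sub>j\<close>; the invariant bridges the two.
\<close>

lemma sturm_gamma_invariant:
  assumes "degree f > 0" "\<And>i. 1 \<le> i \<Longrightarrow> i \<le> k + 1 \<Longrightarrow> sturm_c f i 0 \<noteq> 0"
  shows "sturm_gamma f (k + 2) * sturm_gamma f (k + 1) * (sturm_c f (k + 1) 0)\<^sup>2 * of_nat (degree f) = - 1"
  using assms(2)
proof (induction k)
  case 0
  have "lead_coeff f \<noteq> 0" using assms(1) by auto
  then show ?case using assms(1) sturm_c_one[OF assms(1)]
    by (simp add: numeral_2_eq_2 power2_eq_square field_simps)
next
  case (Suc k)
  have nz: "sturm_c f (Suc (Suc k)) 0 \<noteq> 0" using Suc.prems[of "k + 2"] by simp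
  have IH: "sturm_gamma f (Suc (Suc k)) * sturm_gamma f (Suc k) * (sturm_c f (Suc k) 0)\<^sup>2 * of_nat (degree f) = - 1"
    using Suc.IH Suc.prems by simp
  have "sturm_gamma f (Suc (Suc (Suc k))) * (sturm_c f (Suc (Suc k)) 0)\<^sup>2 =
      sturm_gamma f (Suc k) * (sturm_c f (Suc k) 0)\<^sup>2"
    using nz by simp
  then have "sturm_gamma f (Suc (Suc (Suc k))) * sturm_gamma f (Suc (Suc k)) *
     (sturm_c f (Suc (Suc k)) 0)\<^sup>2 * of_nat (degree f) = - 1"
    using IH by (simp only: mult_ac)
  then show ?case by simp
qed

lemma sturm_seq_one:
  assumes "degree f > 0"
  shows "sturm_seq f 1 = smult (sturm_gamma f 1)
    (\<Sum>p = 0..degree f - 1. monom (sturm_c f 1 p) (degree f - 1 - p))"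
proof -
  define l where "l = of_nat (degree f) * lead_coeff f"
  have l: "l \<noteq> 0" using assms by (auto simp: l_def)
  have "coeff (smult (inverse l) (pderiv f)) e =
      (if e \<le> degree f - 1 then sturm_c f 1 (degree f - 1 - e) else 0)" for e
  proof (cases "e \<le> degree f - 1")
    case True
    then have "int (degree f) - int (degree f - 1 - e) = int (Suc e)" using assms by linarith
    then have "sturm_c f 1 (degree f - 1 - e) = of_int (int (Suc e)) * icoeff f (int (Suc e)) / l"
      by (simp only: sturm_c_def l_def if_True refl)
    moreover have "icoeff f (int (Suc e)) = coeff f (Suc e)"
      by (simp only: icoeff_def nat_int of_nat_less_0_iff if_False)
    ultimately have "sturm_c f 1 (degree f - 1 - e) = of_nat (Suc e) * coeff f (Suc e) / l"
      by (simp only: of_int_of_nat_eq)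
    with True show ?thesis by (simp only: coeff_smult coeff_pderiv divide_inverse mult_ac if_True)
  next
    case False
    then have "coeff f (Suc e) = 0" by (intro coeff_eq_0) simp
    then show ?thesis using False by (simp add: coeff_pderiv)
  qed
  from sum_monom_reversed[OF this] have "smult l (smult (inverse l) (pderiv f)) =
      smult l (\<Sum>p = 0..degree f - 1. monom (sturm_c f 1 p) (degree f - 1 - p))"
    by (rule arg_cong)
  then have "pderiv f = smult l (\<Sum>p = 0..degree f - 1. monom (sturm_c f 1 p) (degree f - 1 - p))"
    by (simp only: smult_smult right_inverse[OF l] smult_1_left)
  then show ?thesis by (simp only: One_nat_def sturm_seq.simps sturm_gamma.simps l_def)
qed

theorem mainTheorem1:
  fixes f :: "'k::field_char_0 poly" and n j :: nat
  assumes "degree f = n" and "n > 0"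
    and "1 \<le> j"
    and "j \<le> n" and "sturm_seq f j \<noteq> 0" and "degree (sturm_seq f j) = n - j"
  shows "(\<forall>i\<le>j. sturm_seq f i \<noteq> 0 \<and> degree (sturm_seq f i) = n - i) \<and>
    (\<forall>i\<in>{1..j}.
       sturm_c f i 0 \<noteq> 0 \<and>
       sturm_seq f i =
         smult (sturm_gamma f i) (\<Sum>p = 0..n - i. monom (sturm_c f i p) (n - i - p)) \<and>
       lead_coeff (sturm_seq f i) = sturm_gamma f i * sturm_c f i 0)"
proof -
  have reg: "sturm_seq f i \<noteq> 0 \<and> degree (sturm_seq f i) + i = degree f" if "i \<le> j" for i
    using sturm_seq_regular[of f j i] assms that by simp
  have deg: "degree (sturm_seq f i) = n - i" if "i \<le> j" for i
    using reg[OF that] assms(1) by auto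
  have key: "sturm_c f i 0 \<noteq> 0 \<and> lead_coeff (sturm_seq f i) = sturm_gamma f i * sturm_c f i 0 \<and>
      sturm_seq f i = smult (sturm_gamma f i) (\<Sum>p = 0..n - i. monom (sturm_c f i p) (n - i - p))"
    if "1 \<le> i" "i \<le> j" for i
    using that
  proof (induction i rule: less_induct)
    case (less i)
    have formula: "sturm_seq f i =
        smult (sturm_gamma f i) (\<Sum>p = 0..n - i. monom (sturm_c f i p) (n - i - p))"
    proof (cases "i = 1")
      case True
      then show ?thesis using sturm_seq_one[of f] assms(1,2) by simp
    next
      case False
      define k where "k = i - 2"
      have i: "i = k + 2" using False less.prems k_def by simp
      have kn: "k + 2 \<le> degree f" using i less.prems assms by simp
      have IH: "sturm_c f m 0 \<noteq> 0" "lead_coeff (sturm_seq f m) = sturm_gamma f m * sturm_c f m 0"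
        if "1 \<le> m" "m \<le> k + 1" for m
      proof -
        have "m < i" "1 \<le> m" "m \<le> j" using that less.prems i by auto
        from less.IH[OF this] show "sturm_c f m 0 \<noteq> 0"
          "lead_coeff (sturm_seq f m) = sturm_gamma f m * sturm_c f m 0" by blast+
      qed
      \<comment> \<open>the factor between the determinantal polynomial and the Sturm remainder\<close>
      define a where "a = - (of_nat n * sturm_c f (k + 1) 0 * lead_coeff (sturm_seq f (k + 1)))"
      have "sturm_gamma f (k + 2) * sturm_gamma f (k + 1) * (sturm_c f (k + 1) 0)\<^sup>2
          * of_nat (degree f) = - 1"
        using assms(1,2) by (intro sturm_gamma_invariant IH(1)) auto
      moreover have "lead_coeff (sturm_seq f (k + 1)) = sturm_gamma f (k + 1) * sturm_c f (k + 1) 0"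
        by (rule IH(2)) auto
      ultimately have a: "sturm_gamma f i * a = 1"
        by (simp only: a_def i assms(1) power2_eq_square mult_minus_right mult_ac minus_minus)
      have "bez_subresultant f k =
          smult (- (of_nat (degree f) * sturm_c f (k + 1) 0 * lead_coeff (sturm_seq f (k + 1))))
            (sturm_seq f (k + 2))"
        using kn by (rule bez_subresultant_sturm) (use reg less.prems i in simp)
      then have "bez_subresultant f k = smult a (sturm_seq f i)"
        by (simp only: a_def i assms(1))
      then have "sturm_seq f i = smult (sturm_gamma f i) (bez_subresultant f k)"
        by (simp only: smult_smult a smult_1_left)
      also have "bez_subresultant f k = (\<Sum>p = 0..n - i. monom (sturm_c f i p) (n - i - p))"
        using coeff_bez_subresultant[OF kn] unfolding i assms(1) by (rule sum_monom_reversed)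
      finally show ?thesis .
    qed
    let ?S = "\<Sum>p = 0..n - i. monom (sturm_c f i p) (n - i - p)"
    have "coeff ?S (n - i) = (\<Sum>p = 0..n - i. if p = 0 then sturm_c f i p else 0)"
      unfolding coeff_sum coeff_monom by (intro sum.cong) auto
    then have "coeff ?S (n - i) = sturm_c f i 0" by simp
    moreover note deg[OF less.prems(2)]
    ultimately have lead: "lead_coeff (sturm_seq f i) = sturm_gamma f i * sturm_c f i 0"
      by (metis formula coeff_smult)
    moreover have "lead_coeff (sturm_seq f i) \<noteq> 0"
      using reg[of i] less.prems by (simp only: leading_coeff_0_iff) simp
    ultimately have "sturm_c f i 0 \<noteq> 0" by auto
    with lead formula show ?case by blast
  qed
  show ?thesis
  proof (intro conjI allI impI ballI)
    fix i assume "i \<in> {1..j}"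
    then have "1 \<le> i" "i \<le> j" by auto
    from key[OF this] show "sturm_c f i 0 \<noteq> 0"
      "sturm_seq f i =
        smult (sturm_gamma f i) (\<Sum>p = 0..n - i. monom (sturm_c f i p) (n - i - p))"
      "lead_coeff (sturm_seq f i) = sturm_gamma f i * sturm_c f i 0" by blast+
  qed (use reg deg in blast)+
qed

end
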